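(* For every integer $k\ge1$ there exists a tree $G_k$ with a $(k,k)$-comatching of size $2^k$.
   Context: Trees and graphs are finite and unweighted; $\mathrm{dist}$ is the shortest-path (hop) distance, and $\mathrm{dist}(v,X)=\min_{x\in X}\mathrm{dist}(v,x)$ for a nonempty vertex set $X$. For integers $k,d\ge1$, a $(k,d)$-comatching in a graph $G$ is a family $\mathcal{M}$ of ordered pairs $(p,X)$, where $p\in V(G)$ and $X\subseteq V(G)$ is a set of $k$ vertices, such that $\mathrm{dist}(p,X)>d$ for every $(p,X)\in\mathcal{M}$, and $\mathrm{dist}(p,X')\le d$ for all distinct $(p,X),(p',X')\in\mathcal{M}$. *)

theory Defs
  imports "Graph_Theory.Graph_Theory"
begin

text \<open>
  Graphs are finite simple undirected graphs, i.e. the locale \<^locale>\<open>graph\<close>: finite loop-free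
  symmetric digraphs without parallel arcs, an undirected edge being a pair of opposite arcs.
\<close>

text \<open>
  The library constant \<^const>\<open>tree\<close> is not the notion of an undirected tree: its \<^const>\<open>forest\<close>
  excludes all directed cycles, and in a symmetric digraph every edge traversed back and forth is
  one, of length 2.  The cycles of the undirected graph are exactly the directed cycles of
  length at least 3.
\<close>

definition undirected_tree :: "('a, 'b) pre_digraph \<Rightarrow> bool" where
  "undirected_tree G \<longleftrightarrow>
     graph G \<and> connected G \<and> \<not> (\<exists>p. pre_digraph.cycle G p \<and> 3 \<le> length p)"

definition hop_dist :: "('a, 'b) pre_digraph \<Rightarrow> 'a \<Rightarrow> 'a \<Rightarrow> ereal" where
  "hop_dist G u v = wf_digraph.\<mu> G (\<lambda>_. 1) u v"

text \<open>Only meaningful for finite nonempty \<open>X\<close>.\<close>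

definition set_hop_dist :: "('a, 'b) pre_digraph \<Rightarrow> 'a \<Rightarrow> 'a set \<Rightarrow> ereal" where
  "set_hop_dist G v X = Min ((\<lambda>x. hop_dist G v x) ` X)"

text \<open>Intended for \<open>k, d \<ge> 1\<close> and a graph \<open>G\<close>; then the sets \<open>X\<close> are finite and nonempty.\<close>

definition comatching ::
  "nat \<Rightarrow> nat \<Rightarrow> ('a, 'b) pre_digraph \<Rightarrow> ('a \<times> 'a set) set \<Rightarrow> bool" where
  "comatching k d G M \<longleftrightarrow>
     (\<forall>(p, X) \<in> M. p \<in> verts G \<and> X \<subseteq> verts G \<and> card X = k) \<and>
     (\<forall>(p, X) \<in> M. set_hop_dist G p X > ereal (real d)) \<and>
     (\<forall>(p, X) \<in> M. \<forall>(p', X') \<in> M.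
        (p, X) \<noteq> (p', X') \<longrightarrow> set_hop_dist G p X' \<le> ereal (real d))"

end

theory Submission
  imports Defs "HOL-Library.Sublist"
begin

text \<open>
  Take the complete binary tree of depth \<open>k\<close>, its vertices being words of length at most \<open>k\<close>, and
  hang a pendant path of length \<open>k\<close> on every vertex.  The centres are the \<open>2 ^ k\<close> leaves \<open>w\<close> of
  the binary tree.  For a vertex \<open>s\<close> at depth \<open>j > 0\<close>, let \<open>x\<^sub>s\<close> be the vertex at distance \<open>j\<close> on the
  path hanging from \<open>s\<close>: it is at distance \<open>(k - j) + j = k\<close> from the leaves below \<open>s\<close>, and at
  distance at least \<open>k + 2\<close> from all other leaves.  Hence the set of those \<open>x\<^sub>s\<close> for which \<open>s\<close> is the
  sibling of an ancestor of \<open>w\<close> (or of \<open>w\<close> itself) has \<open>k\<close> elements, is far from \<open>w\<close>, and is within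
  \<open>k\<close> of every other leaf, because the path from the root to another leaf leaves the path to \<open>w\<close> at
  such a sibling.
\<close>

section \<open>Undirected trees from a parent map\<close>

locale parent_tree =
  fixes V :: "'a set" and r :: 'a and par :: "'a \<Rightarrow> 'a" and rank :: "'a \<Rightarrow> nat"
  assumes finite_V: "finite V"
    and root_in: "r \<in> V"
    and par_in: "\<And>v. v \<in> V \<Longrightarrow> v \<noteq> r \<Longrightarrow> par v \<in> V"
    and rank_par: "\<And>v. v \<in> V \<Longrightarrow> v \<noteq> r \<Longrightarrow> rank (par v) < rank v"
begin

definition edge :: "'a \<Rightarrow> 'a \<Rightarrow> bool" where
  "edge u v \<longleftrightarrow> u \<in> V \<and> v \<in> V \<and> (u \<noteq> r \<and> v = par u \<or> v \<noteq> r \<and> u = par v)"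

definition G :: "('a, 'a \<times> 'a) pre_digraph" where
  "G = \<lparr>verts = V, arcs = {(u, v). edge u v}, tail = fst, head = snd\<rparr>"

lemma G_simps [simp]:
  "verts G = V" "e \<in> arcs G \<longleftrightarrow> edge (fst e) (snd e)" "tail G = fst" "head G = snd"
  by (auto simp: G_def split: prod.splits)

lemma edge_sym: "edge u v \<Longrightarrow> edge v u"
  by (auto simp: edge_def)

lemma graph_G: "graph G"
proof -
  have "arcs G \<subseteq> V \<times> V"
    by (auto simp: edge_def)
  then have "finite (arcs G)"
    using finite_V by (meson finite_SigmaI finite_subset)
  moreover have "symmetric G"
    unfolding symmetric_conv
  proof
    fix e assume "e \<in> arcs G"
    then show "\<exists>e'\<in>arcs G. tail G e = head G e' \<and> head G e = tail G e'"
      by (intro bexI[of _ "(snd e, fst e)"]) (auto intro: edge_sym)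
  qed
  ultimately show ?thesis
    using finite_V rank_par
    by unfold_locales (fastforce simp: edge_def arc_to_ends_def prod_eq_iff)+
qed

sublocale graph G
  by (rule graph_G)

lemma edge_reachable: "edge u v \<Longrightarrow> u \<rightarrow>\<^sup>*\<^bsub>G\<^esub> v"
  by (rule reachable_adjI) (force simp: arcs_ends_conv)

lemma reachable_root: "v \<in> V \<Longrightarrow> v \<rightarrow>\<^sup>*\<^bsub>G\<^esub> r"
proof (induction "rank v" arbitrary: v rule: less_induct)
  case less
  show ?case
  proof (cases "v = r")
    case True
    then show ?thesis using root_in by simp
  next
    case False
    with less have "edge v (par v)" "par v \<rightarrow>\<^sup>*\<^bsub>G\<^esub> r"
      by (auto simp: edge_def par_in rank_par)
    then show ?thesis
      using edge_reachable reachable_trans by blast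
  qed
qed

lemma connected_G: "connected G"
  unfolding connected_def
proof (rule strongly_connectedI)
  show "verts (with_proj (mk_symmetric G)) \<noteq> {}"
    using root_in by auto
  fix u v assume "u \<in> verts (with_proj (mk_symmetric G))" "v \<in> verts (with_proj (mk_symmetric G))"
  then have "u \<rightarrow>\<^sup>*\<^bsub>G\<^esub> r" "r \<rightarrow>\<^sup>*\<^bsub>G\<^esub> v"
    by (auto intro: reachable_root symmetric_reachable')
  then show "u \<rightarrow>\<^sup>*\<^bsub>with_proj (mk_symmetric G)\<^esub> v"
    by (blast intro: reachable_trans reachable_mk_symmetricI)
qed

text \<open>At a vertex of maximal rank on a cycle, both neighbours on the cycle are its parent.\<close>

lemma no_cycle:
  assumes "cycle p"
  shows "length p < 3"
proof (rule ccontr)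
  assume "\<not> length p < 3"
  define n where "n = length p"
  define h where "h i = snd (p ! (i mod n))" for i
  have n: "n \<ge> 3" "p \<noteq> []"
    using \<open>\<not> length p < 3\<close> by (auto simp: n_def)
  from assms obtain u where walk: "awalk u p u" and dist: "distinct (tl (awalk_verts u p))"
    unfolding cycle_def by blast
  \<comment> \<open>The vertices of the closed walk, read off from tails and from heads; comparing
    the two lists makes each head the next tail.\<close>
  have verts1: "awalk_verts u p = map fst p @ [u]"
    using walk n by (metis G_simps(3) awalkE awalk_verts_conv last_snoc)
  have verts2: "awalk_verts u p = u # map snd p"
    using walk n by (metis G_simps(4) awalkE awalk_verts_conv' list.sel(1))
  have arc: "edge (fst (p ! i)) (snd (p ! i))" if "i < n" for i
    using walk that by (auto simp: awalk_def n_def subset_iff)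
  have h_edge: "edge (h i) (h (Suc i))" for i
  proof -
    have lt: "i mod n < n" using n by simp
    have "h i = (u # map snd p) ! Suc (i mod n)"
      using lt by (simp add: h_def n_def)
    also have "\<dots> = (map fst p @ [u]) ! Suc (i mod n)"
      using verts1 verts2 by simp
    also have "\<dots> = fst (p ! (Suc i mod n))"
    proof (cases "Suc (i mod n) = n")
      case True
      have "u = fst (p ! 0)"
        using verts1 verts2 n by (cases p) auto
      then show ?thesis
        using True by (simp add: mod_Suc nth_append n_def)
    next
      case False
      then have "Suc (i mod n) < n" using lt by simp
      then show ?thesis by (simp add: mod_Suc nth_append n_def)
    qed
    finally show ?thesis
      using arc[of "Suc i mod n"] n by (simp add: h_def)
  qed
  have h_inj: "i mod n = j mod n" if "h i = h j" for i j
  proof -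
    have "i mod n < length (map snd p)" "j mod n < length (map snd p)" "distinct (map snd p)"
      using n dist verts2 by (auto simp: n_def)
    then show ?thesis
      using that by (metis h_def length_map nth_eq_iff_index_eq nth_map)
  qed
  obtain m where m: "m < n" "\<And>i. i < n \<Longrightarrow> rank (h i) \<le> rank (h m)"
  proof -
    have "Max ((rank \<circ> h) ` {..<n}) \<in> (rank \<circ> h) ` {..<n}"
      using n by (intro Max_in) (auto simp: lessThan_empty_iff)
    then obtain m where "m < n" "rank (h m) = Max ((rank \<circ> h) ` {..<n})"
      by auto
    then show thesis using that[of m] by simp
  qed
  have max: "rank (h i) \<le> rank (h m)" for i
    using m(2)[of "i mod n"] n by (simp add: h_def)
  \<comment> \<open>The index before \<open>m\<close> on the cycle; adding \<open>n\<close> avoids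
    truncated subtraction at \<open>m = 0\<close>. Equal neighbours \<open>h (Suc m)\<close> and
    \<open>h l\<close> will force \<open>n\<close> to divide 2.\<close>
  define l where "l = m + n - 1"
  have l: "h (Suc l) = h m"
    using n by (simp add: h_def l_def)
  have up: "v = par (h m)" if "edge (h m) v" "rank v \<le> rank (h m)" for v
    using that rank_par[of v] by (auto simp: edge_def)
  have "h (Suc m) = par (h m)" "h l = par (h m)"
    using h_edge[of m] edge_sym[OF h_edge[of l]] l max by (auto intro!: up)
  then have "Suc m mod n = l mod n"
    by (intro h_inj) simp
  then have "int (Suc m) mod int n = int l mod int n"
    by (metis zmod_int)
  then have "int n dvd int l - int (Suc m)"
    by (metis mod_eq_dvd_iff)
  then have "int n dvd int n - 2"
    using n by (simp add: l_def of_nat_diff)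
  then have "int n dvd 2"
    by (metis dvd_diff_right_iff dvd_refl diff_diff_eq2 dvd_minus_iff minus_diff_eq)
  then show False
    using n zdvd_imp_le by fastforce
qed

lemma undirected_tree_G: "undirected_tree G"
  using graph_G connected_G no_cycle by (force simp: undirected_tree_def)

section \<open>Distance bounds\<close>

lemma hop_dist_le:
  assumes "g 0 \<in> V" "\<And>i. i < n \<Longrightarrow> edge (g i) (g (Suc i))"
  shows "hop_dist G (g 0) (g n) \<le> ereal (real n)"
proof -
  have "awalk (g 0) (map (\<lambda>i. (g i, g (Suc i))) [0..<n]) (g n)"
    using assms(2)
  proof (induction n)
    case 0
    then show ?case using assms(1) by (simp add: awalk_Nil_iff)
  next
    case (Suc n)
    then have "awalk (g n) [(g n, g (Suc n))] (g (Suc n))"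
      by (auto simp: awalk_def edge_def)
    with Suc show ?case
      by auto
  qed
  from min_cost_le_walk_cost[OF this, of "\<lambda>_. 1"] show ?thesis
    by (simp add: hop_dist_def awalk_cost_def comp_def sum_list_triv)
qed

text \<open>Each arc lowers \<open>f\<close> by at most 1, so a walk from \<open>u\<close> to
  \<open>v\<close> has at least \<open>f u - f v\<close> arcs; the distance is the infimum over all
  walks.\<close>

lemma hop_dist_ge:
  fixes f :: "'a \<Rightarrow> int"
  assumes f: "\<And>v. v \<in> V \<Longrightarrow> v \<noteq> r \<Longrightarrow> \<bar>f v - f (par v)\<bar> \<le> 1"
  shows "ereal (real_of_int (f u - f v)) \<le> hop_dist G u v"
proof -
  have "real_of_int (f u - f v) \<le> awalk_cost (\<lambda>_. 1) p" if "awalk u p v" for p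
    using that
  proof (induction p arbitrary: u)
    case Nil
    then show ?case by (simp add: awalk_Nil_iff)
  next
    case (Cons e p)
    then have e: "edge u (snd e)" and "awalk (snd e) p v"
      by (auto simp: awalk_Cons_iff)
    then have "real_of_int (f (snd e) - f v) \<le> awalk_cost (\<lambda>_. 1) p"
      using Cons.IH by blast
    moreover have "f u - f (snd e) \<le> 1"
      using e f[of u] f[of "snd e"] by (auto simp: edge_def)
    ultimately show ?case by simp
  qed
  then show ?thesis
    unfolding hop_dist_def \<mu>_def by (auto intro!: INF_greatest)
qed

end

section \<open>The concrete tree and its far sets\<close>

text \<open>
  The vertex \<open>(v, m)\<close> is the one at distance \<open>m\<close> on the path hanging from \<open>v\<close>.  Words are written
  from the leaf to the root, so that \<^const>\<open>tl\<close> is the parent map and the ancestors of a word are its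
  suffixes.
\<close>

type_synonym vertex = "bool list \<times> nat"

definition V0 :: "nat \<Rightarrow> vertex set" where
  "V0 k = {v. length v \<le> k} \<times> {..k}"

fun par0 :: "vertex \<Rightarrow> vertex" where
  "par0 (v, 0) = (tl v, 0)"
| "par0 (v, Suc m) = (v, m)"

text \<open>\<open>drop i w\<close> is the ancestor of \<open>w\<close> that lies \<open>i\<close>
  levels up; this is the other child of its parent.\<close>

definition sibling :: "bool list \<Rightarrow> nat \<Rightarrow> bool list" where
  "sibling w i = (\<not> w ! i) # drop (Suc i) w"

lemma length_sibling: "i < length w \<Longrightarrow> length (sibling w i) = length w - i"
  by (simp add: sibling_def)

lemma drop_neq_sibling: "i < length w \<Longrightarrow> drop i w \<noteq> sibling w i"
  by (simp add: sibling_def flip: Cons_nth_drop_Suc)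

lemma not_suffix_sibling: "i < length w \<Longrightarrow> \<not> suffix (sibling w i) w"
  by (metis drop_neq_sibling length_sibling suffix_drop length_drop suffix_length_suffix
      suffix_order.antisym order_refl)

text \<open>Just below their lowest common ancestor, the two words pass through different
  children.\<close>

lemma ex_drop_eq_sibling:
  "length w = length w' \<Longrightarrow> w \<noteq> w' \<Longrightarrow> \<exists>i<length w. drop i w' = sibling w i"
proof (induction w w' rule: list_induct2)
  case (Cons a v b u)
  show ?case
  proof (cases "v = u")
    case True
    with Cons show ?thesis by (intro exI[of _ 0]) (auto simp: sibling_def)
  next
    case False
    with Cons obtain i where "i < length v" "drop i u = sibling v i" by blast
    then show ?thesis by (intro exI[of _ "Suc i"]) (simp add: sibling_def)
  qed
qed simp

text \<open>For a leaf \<open>w\<close>, the offset \<open>k - i\<close> is the depth of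
  \<open>sibling w i\<close>.\<close>

definition far :: "nat \<Rightarrow> bool list \<Rightarrow> vertex set" where
  "far k w = (\<lambda>i. (sibling w i, k - i)) ` {..<k}"

lemma card_far: "card (far k w) = k"
  unfolding far_def by (subst card_image) (auto simp: inj_on_def)

lemma far_subset: "length w = k \<Longrightarrow> far k w \<subseteq> V0 k"
  by (auto simp: far_def V0_def length_sibling)

text \<open>
  A function that changes by at most 1 along every edge, so that its differences bound distances from
  below.  It is 0 at \<open>s\<close> and 1 at the parent of \<open>s\<close> and grows with the depth both below \<open>s\<close> and outside
  the subtree of \<open>s\<close>; it is negative on the path hanging from \<open>s\<close> and constant on every other
  pendant path.
\<close>

fun potential :: "bool list \<Rightarrow> vertex \<Rightarrow> int" where
  "potential s (v, m) =
     (if v = s then - int m else int (length v) - int (length s) + (if suffix s v then 0 else 2))"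

text \<open>The summand 2 appears only on the edge from \<open>s\<close> to its parent, where the
  depth drops by 1, so the net change is 1.\<close>

lemma potential_par0:
  assumes "v \<noteq> ([], 0)"
  shows "\<bar>potential s v - potential s (par0 v)\<bar> \<le> 1"
proof (cases v rule: par0.cases)
  case (1 w)
  with assms obtain a t where "w = a # t" by (cases w) auto
  with 1 show ?thesis
    by (auto simp: suffix_Cons dest: suffix_length_le)
qed auto

lemma set_hop_dist_le:
  assumes "finite X" "x \<in> X" "hop_dist G p x \<le> c"
  shows "set_hop_dist G p X \<le> c"
  using assms unfolding set_hop_dist_def by (meson Min_le finite_imageI image_eqI order_trans)

theorem theorem1p12:
  fixes k :: nat
  assumes "k \<ge> 1"
  shows "\<exists>G :: (nat, nat \<times> nat) pre_digraph.
           undirected_tree G \<and>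
           (\<exists>M. comatching k k G M \<and> finite M \<and> card M = 2 ^ k)"
proof -
  define L where "L = {w :: bool list. length w = k}"
  define M :: "(nat \<times> nat set) set"
    where "M = (\<lambda>w. (to_nat (w, 0 :: nat), to_nat ` far k w)) ` L"
  \<comment> \<open>\<open>to_nat\<close> encodes the vertices as the required natural numbers; the
    rank is the depth, pendant paths included.\<close>
  interpret T: parent_tree "to_nat ` V0 k" "to_nat (([], 0) :: vertex)"
    "to_nat \<circ> par0 \<circ> from_nat" "\<lambda>n. case from_nat n :: vertex of (v, m) \<Rightarrow> length v + m"
  proof
    have "finite {v :: bool list. length v \<le> k}"
      using finite_lists_length_le[of "UNIV :: bool set" k] by simp
    then show "finite (to_nat ` V0 k)"
      by (simp add: V0_def)
    show "to_nat (([], 0) :: vertex) \<in> to_nat ` V0 k"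
      by (auto simp: V0_def)
  next
    fix n assume n: "n \<in> to_nat ` V0 k" "n \<noteq> to_nat (([], 0) :: vertex)"
    then obtain v m where v: "n = to_nat (v, m)" "(v, m) \<in> V0 k" by auto
    show "(to_nat \<circ> par0 \<circ> from_nat) n \<in> to_nat ` V0 k"
      using v by (cases m) (auto simp: V0_def)
    show "(case from_nat ((to_nat \<circ> par0 \<circ> from_nat) n) :: vertex of (v, m) \<Rightarrow> length v + m)
        < (case from_nat n :: vertex of (v, m) \<Rightarrow> length v + m)"
      using v n by (cases m; cases v) auto
  qed
  have edge_par: "T.edge (to_nat v) (to_nat (par0 v))"
    if "v \<in> V0 k" "v \<noteq> ([], 0)" for v
    using that T.par_in[of "to_nat v"] by (auto simp: T.edge_def)
  have far_dist: "set_hop_dist T.G (to_nat (w, 0 :: nat)) (to_nat ` far k w) > ereal (real k)"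
    if w: "w \<in> L" for w
  proof -
    have "ereal (real k) < hop_dist T.G (to_nat (w, 0 :: nat)) (to_nat (sibling w i, k - i))"
      if i: "i < k" for i
    proof -
      let ?s = "sibling w i"
      \<comment> \<open>As \<open>w\<close> is not below \<open>?s\<close>, the potentials are
        \<open>i + 2\<close> and \<open>-(k - i)\<close>, which differ by
        \<open>k + 2\<close>.\<close>
      have "ereal (real k) < ereal (real_of_int (potential ?s (w, 0) - potential ?s (?s, k - i)))"
        using w i not_suffix_sibling[of i w] length_sibling[of i w] by (auto simp: L_def)
      also have "\<dots> \<le> hop_dist T.G (to_nat (w, 0 :: nat)) (to_nat (?s, k - i))"
        using T.hop_dist_ge[of "potential ?s \<circ> from_nat" "to_nat (w, 0 :: nat)" "to_nat (?s, k - i)"]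
          potential_par0[of _ ?s]
        by fastforce
      finally show ?thesis .
    qed
    then show ?thesis
      using assms unfolding set_hop_dist_def
      by (subst Min_gr_iff) (auto simp: far_def lessThan_empty_iff)
  qed
  have near_dist: "set_hop_dist T.G (to_nat (w', 0 :: nat)) (to_nat ` far k w) \<le> ereal (real k)"
    if w: "w \<in> L" "w' \<in> L" "w \<noteq> w'" for w w'
  proof -
    obtain i where i: "i < k" "drop i w' = sibling w i"
      using ex_drop_eq_sibling[of w w'] w by (auto simp: L_def)
    \<comment> \<open>Climb \<open>i\<close> steps from \<open>w'\<close>, then follow the pendant
      path for \<open>k - i\<close> steps; both branches agree at \<open>j = i\<close>.\<close>
    define g :: "nat \<Rightarrow> vertex"
      where "g j = (if j \<le> i then (drop j w', 0) else (sibling w i, j - i))" for j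
    have len: "length (sibling w i) \<le> k" "length w' = k"
      using i w by (auto simp: L_def length_sibling)
    have "T.edge (to_nat (g j)) (to_nat (g (Suc j)))" if j: "j < k" for j
    proof (cases "j < i")
      case True
      then have "g (Suc j) = par0 (g j)" "g j \<in> V0 k" "g j \<noteq> ([], 0)"
        using len i by (auto simp: g_def V0_def drop_Suc tl_drop)
      then show ?thesis using edge_par by metis
    next
      case False
      then have "g j = par0 (g (Suc j))" "g (Suc j) \<in> V0 k" "g (Suc j) \<noteq> ([], 0)"
        using len i j by (auto simp: g_def V0_def Suc_diff_le)
      then show ?thesis using edge_par T.edge_sym by metis
    qed
    then have "hop_dist T.G (to_nat (g 0)) (to_nat (g k)) \<le> ereal (real k)"
      using len by (intro T.hop_dist_le) (auto simp: g_def V0_def)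
    then show ?thesis
      using i by (intro set_hop_dist_le[where x = "to_nat (g k)"])
        (auto simp: g_def far_def)
  qed
  have "comatching k k T.G M"
    unfolding comatching_def
  proof (intro conjI)
    show "\<forall>(p, X)\<in>M. p \<in> verts T.G \<and> X \<subseteq> verts T.G \<and> card X = k"
    proof -
      have "(w, 0) \<in> V0 k \<and> far k w \<subseteq> V0 k" if "w \<in> L" for w
        using that far_subset[of w k] by (auto simp: L_def V0_def)
      moreover have "card (to_nat ` far k w) = k" for w
        by (simp add: card_image card_far)
      ultimately show ?thesis
        by (auto simp: M_def)
    qed
    show "\<forall>(p, X)\<in>M. ereal (real k) < set_hop_dist T.G p X"
      using far_dist by (auto simp: M_def)
    show "\<forall>(p, X)\<in>M. \<forall>(p', X')\<in>M. (p, X) \<noteq> (p', X') \<longrightarrow>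
        set_hop_dist T.G p X' \<le> ereal (real k)"
      using near_dist unfolding M_def by fast
  qed
  moreover have "finite L" "card L = 2 ^ k"
    using finite_lists_length_eq[of "UNIV :: bool set" k] card_lists_length_eq[of "UNIV :: bool set" k]
    by (auto simp: L_def)
  then have "finite M" "card M = 2 ^ k"
    by (auto simp: M_def card_image inj_on_def)
  ultimately show ?thesis
    using T.undirected_tree_G by blast
qed

end
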